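(* Let $L$ be a field of characteristic 2, let $\alpha\in L$ be transcendental over $\mathbb{Z}/2$, and let $Q\ge 2$ be a power of 2. Then $N_{6Q-5}=(0)$, i.e. multiplication by $g_\alpha$ is an injective map $O_{6Q-5}\to O_{6Q-1}$.
   Context: $P=z^{4}+xyz^{2}+(x^{3}+y^{3})z\in L[x,y,z]$ and $g_\alpha=P+\alpha x^{2}y^{2}$. $O$ is the graded $L$-algebra $L[x,y,z]/(x^{4Q},y^{4Q},z^{4Q})$ (standard grading), with degree $j$ component $O_j$. $N_{6Q-5}$ is the kernel of the map $O_{6Q-5}\to O_{6Q-1}$ given by multiplication by $g_\alpha$. *)

theory Defs
  imports
    "HOL-Library.Poly_Mapping"
    "HOL-Library.Product_Plus"
    "HOL-Algebra.QuotRing"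
    "HOL-Algebra.Finite_Extensions"
    "HOL-Algebra.Algebraic_Closure_Type"
begin

text \<open>
  \<open>L[x,y,z]\<close> is the monoid algebra of \<open>\<nat>\<^sup>3\<close> over \<open>L\<close>: the key \<open>(i, j, k)\<close> is the exponent
  vector of the monomial \<open>x\<^sup>i y\<^sup>j z\<^sup>k\<close>, and the product of \<^theory>\<open>HOL-Library.Poly_Mapping\<close> is
  convolution with respect to the componentwise addition of exponents.
\<close>

type_synonym 'a poly3 = "(nat \<times> nat \<times> nat) \<Rightarrow>\<^sub>0 'a"

definition const3 :: "'a::comm_ring_1 \<Rightarrow> 'a poly3" where
  "const3 c = Poly_Mapping.single (0, 0, 0) c"

definition var_x :: "'a::comm_ring_1 poly3" where
  "var_x = Poly_Mapping.single (1, 0, 0) 1"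

definition var_y :: "'a::comm_ring_1 poly3" where
  "var_y = Poly_Mapping.single (0, 1, 0) 1"

definition var_z :: "'a::comm_ring_1 poly3" where
  "var_z = Poly_Mapping.single (0, 0, 1) 1"

definition homogeneous3 :: "nat \<Rightarrow> 'a::comm_ring_1 poly3 set" where
  "homogeneous3 d = {f. \<forall>(i, j, k) \<in> Poly_Mapping.keys f. i + j + k = d}"

definition P_poly :: "'a::comm_ring_1 poly3" where
  "P_poly = var_z ^ 4 + var_x * var_y * var_z ^ 2 + (var_x ^ 3 + var_y ^ 3) * var_z"

definition g_poly :: "'a::comm_ring_1 \<Rightarrow> 'a poly3" where
  "g_poly \<alpha> = P_poly + const3 \<alpha> * var_x ^ 2 * var_y ^ 2"

abbreviation poly3_ring :: "'a::comm_ring_1 poly3 ring" where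
  "poly3_ring \<equiv> ring_of_type_algebra"

definition O_ideal :: "nat \<Rightarrow> 'a::comm_ring_1 poly3 set" where
  "O_ideal Q = Idl\<^bsub>poly3_ring\<^esub> {var_x ^ (4 * Q), var_y ^ (4 * Q), var_z ^ (4 * Q)}"

definition O_ring :: "nat \<Rightarrow> 'a::comm_ring_1 poly3 set ring" where
  "O_ring Q = poly3_ring Quot O_ideal Q"

definition O_class :: "nat \<Rightarrow> 'a::comm_ring_1 poly3 \<Rightarrow> 'a poly3 set" where
  "O_class Q f = O_ideal Q +>\<^bsub>poly3_ring\<^esub> f"

definition O_component :: "nat \<Rightarrow> nat \<Rightarrow> 'a::comm_ring_1 poly3 set set" where
  "O_component Q j = O_class Q ` homogeneous3 j"

definition mult_g :: "nat \<Rightarrow> 'a::comm_ring_1 \<Rightarrow> 'a poly3 set \<Rightarrow> 'a poly3 set" where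
  "mult_g Q \<alpha> u = O_class Q (g_poly \<alpha>) \<otimes>\<^bsub>O_ring Q\<^esub> u"

definition N_kernel :: "nat \<Rightarrow> 'a::comm_ring_1 \<Rightarrow> nat \<Rightarrow> 'a poly3 set set" where
  "N_kernel Q \<alpha> j = {u \<in> O_component Q j. mult_g Q \<alpha> u = \<zero>\<^bsub>O_ring Q\<^esub>}"

text \<open>
  In a field of characteristic 2 the image of \<open>\<int>/2\<close>, i.e. the prime field, is \<open>{0, 1}\<close>.
\<close>

definition transcendental_over_F2 :: "'a::field \<Rightarrow> bool" where
  "transcendental_over_F2 \<alpha> \<longleftrightarrow>
     (ring.transcendental (ring_of_type_algebra :: 'a ring) over {0, 1}) \<alpha>"

end

theory Submission
  imports Defs
begin

text \<open>
  The idea is to compare degrees in the transcendental \<open>\<alpha>\<close>.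

  Up to sign, which does not matter in characteristic 2, reduction modulo \<open>g\<close> replaces \<open>z\<^sup>4\<close> by
  \<open>A z\<^sup>2 + B z + C\<close> with \<open>A = x y\<close>, \<open>B = x\<^sup>3 + y\<^sup>3\<close>, \<open>C = \<alpha> x\<^sup>2 y\<^sup>2\<close>. Since \<open>g - C\<close> is an additive
  polynomial in \<open>z\<close>, repeated squaring gives
  \<open>z\<^bsup>4Q\<^esup> = \<alpha>\<^bsup>Q\<^esup> (x y)\<^bsup>2Q\<^esup> + a z\<^sup>2 + b z + c\<close> modulo \<open>g\<close>, where \<open>a\<close>, \<open>b\<close>, \<open>c\<close> do not involve \<open>z\<close>,
  the coefficients of \<open>a\<close> and \<open>b\<close> lie in \<open>\<int>/2\<close>, and those of \<open>c\<close> are polynomials over \<open>\<int>/2\<close> in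
  \<open>\<alpha>\<close> of degree less than \<open>Q\<close> (\<open>z_power_reduction\<close>).

  Let \<open>f\<close> of degree \<open>6Q - 5\<close> have all exponents less than \<open>4Q\<close>, and let \<open>g f\<close> vanish in \<open>O\<close>. Then
  \<open>g f = z\<^bsup>4Q\<^esup> h\<close> modulo \<open>(x\<^bsup>4Q\<^esup>, y\<^bsup>4Q\<^esup>)\<close> with \<open>h\<close> homogeneous of degree \<open>2Q - 1\<close> and of \<open>z\<close>-degree
  at most 3. So the remainder of \<open>z\<^bsup>4Q\<^esup> h\<close> on division by the monic \<open>g\<close> lies in
  \<open>(x\<^bsup>4Q\<^esup>, y\<^bsup>4Q\<^esup>)\<close> (\<open>g_poly_remainder\<close>). That remainder is \<open>\<alpha>\<^bsup>Q\<^esup> (x y)\<^bsup>2Q\<^esup> h\<close> plus an expression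
  linear in the coefficients of \<open>h\<close> whose multipliers have \<open>\<alpha>\<close>-degree less than \<open>Q\<close>; for this
  \<open>Q \<ge> 2\<close> is needed, because reducing \<open>a z\<^sup>4\<close> and its relatives brings in the coefficient \<open>\<alpha>\<close>
  of \<open>C\<close> (\<open>quadratic_times_z_power_reduction\<close>). As \<open>h\<close> has degree less than \<open>2Q\<close>, no monomial of
  \<open>(x y)\<^bsup>2Q\<^esup> h\<close> lies in \<open>(x\<^bsup>4Q\<^esup>, y\<^bsup>4Q\<^esup>)\<close>. Comparing coefficients there gives a square linear system
  for the coefficients of \<open>h\<close> whose matrix is \<open>\<alpha>\<^bsup>Q\<^esup>\<close> times the identity plus entries of smaller degree
  in \<open>\<alpha>\<close>. Its determinant is a monic polynomial in \<open>\<alpha>\<close> over \<open>\<int>/2\<close>, hence nonzero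
  (\<open>dominant_diagonal_system_trivial\<close>). Therefore \<open>h = 0\<close>, and then \<open>f = 0\<close> because \<open>g\<close> is monic
  in \<open>z\<close>.
\<close>

section \<open>Polynomials as sums of monomials\<close>

abbreviation coeff3 :: "'a::zero poly3 \<Rightarrow> nat \<times> nat \<times> nat \<Rightarrow> 'a" where
  "coeff3 \<equiv> Poly_Mapping.lookup"

lemma sum_of_monomials:
  fixes f :: "'a::comm_ring_1 poly3"
  shows "f = (\<Sum>m\<in>Poly_Mapping.keys f. Poly_Mapping.single m (coeff3 f m))"
  by (rule poly_mapping_eqI)
    (auto simp: lookup_sum lookup_single when_def in_keys_iff)

lemma lookup_single_times:
  fixes f :: "'a::comm_ring_1 poly3"
  shows "coeff3 (Poly_Mapping.single (a, b, c) s * f) (i, j, k) =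
    (if a \<le> i \<and> b \<le> j \<and> c \<le> k then s * coeff3 f (i - a, j - b, k - c) else 0)"
proof -
  have "Poly_Mapping.single (a, b, c) s * f = Poly_Mapping.single (a, b, c) s *
      (\<Sum>m\<in>Poly_Mapping.keys f. Poly_Mapping.single m (coeff3 f m))"
    by (rule arg_cong[OF sum_of_monomials])
  also have "\<dots> =
      (\<Sum>m\<in>Poly_Mapping.keys f. Poly_Mapping.single ((a, b, c) + m) (s * coeff3 f m))"
    by (simp only: sum_distrib_left mult_single)
  finally have "coeff3 (Poly_Mapping.single (a, b, c) s * f) (i, j, k) =
      (\<Sum>m\<in>Poly_Mapping.keys f. if (a, b, c) + m = (i, j, k) then s * coeff3 f m else 0)"
    by (simp add: lookup_sum lookup_single when_def del: add_Pair)
  also have "\<dots> = (\<Sum>m\<in>Poly_Mapping.keys f. if m = (i - a, j - b, k - c) then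
      (if a \<le> i \<and> b \<le> j \<and> c \<le> k then s * coeff3 f m else 0) else 0)"
    by (rule sum.cong) (auto split: if_splits)
  also have "\<dots> = (if a \<le> i \<and> b \<le> j \<and> c \<le> k then s * coeff3 f (i - a, j - b, k - c) else 0)"
    by (auto simp: in_keys_iff)
  finally show ?thesis .
qed

lemma monomial_power:
  "Poly_Mapping.single (a, b, c) (s::'a::comm_ring_1) ^ n =
    Poly_Mapping.single (n * a, n * b, n * c) (s ^ n)"
  by (induction n) (auto simp: mult_single algebra_simps simp flip: single_one zero_prod_def)

lemmas var_defs = var_x_def var_y_def var_z_def const3_def

section \<open>Monomial ideals\<close>

text \<open>
  One predicate serves for monomial ideals, for homogeneous components and for bounds on the
  \<open>z\<close>-degree: each of them is given by a set of allowed exponent vectors.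
\<close>

definition supported :: "(nat \<times> nat \<times> nat) set \<Rightarrow> 'a::comm_ring_1 poly3 set" where
  "supported S = {f. Poly_Mapping.keys f \<subseteq> S}"

lemma supported_zero [simp]: "0 \<in> supported S"
  by (simp add: supported_def)

lemma supported_add: "f \<in> supported S \<Longrightarrow> g \<in> supported S \<Longrightarrow> f + g \<in> supported S"
  unfolding supported_def using keys_add[of f g] by blast

lemma supported_uminus [simp]: "- f \<in> supported S \<longleftrightarrow> f \<in> supported S"
  by (simp add: supported_def subset_iff in_keys_iff)

lemma supported_diff: "f \<in> supported S \<Longrightarrow> g \<in> supported S \<Longrightarrow> f - g \<in> supported S"
  using supported_add[of f S "- g"] by simp

lemma supported_sum: "(\<And>i. i \<in> I \<Longrightarrow> f i \<in> supported S) \<Longrightarrow> sum f I \<in> supported S"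
  by (induction I rule: infinite_finite_induct) (auto intro: supported_add)

lemma supported_mult:
  assumes "f \<in> supported S" "g \<in> supported T" "\<And>a b. a \<in> S \<Longrightarrow> b \<in> T \<Longrightarrow> a + b \<in> U"
  shows "f * g \<in> supported U"
  using assms keys_mult[of f g] unfolding supported_def by blast

lemma supported_single [simp]: "Poly_Mapping.single m c \<in> supported S \<longleftrightarrow> c = 0 \<or> m \<in> S"
  by (auto simp: supported_def)

lemma supported_iff: "f \<in> supported S \<longleftrightarrow> (\<forall>m. m \<notin> S \<longrightarrow> coeff3 f m = 0)"
  by (auto simp: supported_def in_keys_iff)

lemma supported_coeff: "f \<in> supported S \<Longrightarrow> m \<notin> S \<Longrightarrow> coeff3 f m = 0"
  by (cases m) (simp add: supported_iff)

lemma homogeneous3_supported: "homogeneous3 d = supported {(i, j, k). i + j + k = d}"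
  by (auto simp: homogeneous3_def supported_def)

abbreviation big_xy :: "nat \<Rightarrow> (nat \<times> nat \<times> nat) set" where
  "big_xy N \<equiv> {(i, j, k). N \<le> i \<or> N \<le> j}"

abbreviation big_xyz :: "nat \<Rightarrow> (nat \<times> nat \<times> nat) set" where
  "big_xyz N \<equiv> {(i, j, k). N \<le> i \<or> N \<le> j \<or> N \<le> k}"

lemma big_xy_mult: "f \<in> supported (big_xy N) \<Longrightarrow> g * f \<in> supported (big_xy N)"
  by (rule supported_mult[of g UNIV f "big_xy N"]) (auto simp: supported_def)

lemma big_xyz_mult: "f \<in> supported (big_xyz N) \<Longrightarrow> g * f \<in> supported (big_xyz N)"
  by (rule supported_mult[of g UNIV f "big_xyz N"]) (auto simp: supported_def)

lemma poly3_ring_simps [simp]: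
  "carrier (poly3_ring :: 'a::comm_ring_1 poly3 ring) = UNIV"
  "x \<otimes>\<^bsub>(poly3_ring :: 'a poly3 ring)\<^esub> y = x * y"
  "x \<oplus>\<^bsub>(poly3_ring :: 'a poly3 ring)\<^esub> y = x + y"
  "\<zero>\<^bsub>(poly3_ring :: 'a poly3 ring)\<^esub> = 0"
  "\<one>\<^bsub>(poly3_ring :: 'a poly3 ring)\<^esub> = 1"
  by (simp_all add: ring_of_type_algebra_def)

lemma cring_poly3: "cring (poly3_ring :: 'a::comm_ring_1 poly3 ring)"
  by (rule cring_from_type_algebra)

lemma poly3_a_inv: "\<ominus>\<^bsub>(poly3_ring :: 'a::comm_ring_1 poly3 ring)\<^esub> x = - x"
proof -
  interpret cring "poly3_ring :: 'a poly3 ring" by (rule cring_poly3)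
  have "x \<oplus>\<^bsub>(poly3_ring :: 'a poly3 ring)\<^esub> (- x) = \<zero>\<^bsub>(poly3_ring :: 'a poly3 ring)\<^esub>"
    by simp
  thus ?thesis
    by (intro minus_equality) (auto simp: add.commute)
qed

lemma poly3_minus: "x \<ominus>\<^bsub>(poly3_ring :: 'a::comm_ring_1 poly3 ring)\<^esub> y = x - y"
  by (simp add: a_minus_def poly3_a_inv)

lemma ideal_supported_big_xyz:
  "ideal (supported (big_xyz N)) (poly3_ring :: 'a::comm_ring_1 poly3 ring)"
proof -
  interpret cring "poly3_ring :: 'a poly3 ring" by (rule cring_poly3)
  show ?thesis
  proof (rule idealI)
    show "subgroup (supported (big_xyz N)) (add_monoid (poly3_ring :: 'a poly3 ring))"
      by (rule add.subgroupI) (auto simp: poly3_a_inv intro: supported_add supported_zero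
          simp flip: a_inv_def)
  qed (use big_xyz_mult in \<open>auto simp: mult.commute ring_axioms\<close>)
qed

text \<open>
  An ideal generated by monomials consists of the polynomials all of whose monomials are multiples of
  generators, so membership can be read off from the coefficients.
\<close>

lemma O_ideal_eq: "(O_ideal Q :: 'a::comm_ring_1 poly3 set) = supported (big_xyz (4 * Q))"
proof
  interpret cring "poly3_ring :: 'a poly3 ring" by (rule cring_poly3)
  show "O_ideal Q \<subseteq> (supported (big_xyz (4 * Q)) :: 'a poly3 set)"
    unfolding O_ideal_def
    by (rule genideal_minimal[OF ideal_supported_big_xyz]) (auto simp: var_defs monomial_power)
  interpret I: ideal "O_ideal Q" "poly3_ring :: 'a poly3 ring"
    unfolding O_ideal_def by (rule genideal_ideal) auto
  have gen: "var_x ^ (4 * Q) \<in> (O_ideal Q :: 'a poly3 set)"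
      "var_y ^ (4 * Q) \<in> (O_ideal Q :: 'a poly3 set)"
      "var_z ^ (4 * Q) \<in> (O_ideal Q :: 'a poly3 set)"
    unfolding O_ideal_def by (auto intro: subsetD[OF genideal_self])
  have mult: "p * s \<in> O_ideal Q" if "s \<in> O_ideal Q" for p s :: "'a poly3"
    using I.I_l_closed[OF that, of p] by simp
  have mono: "Poly_Mapping.single m c \<in> (O_ideal Q :: 'a poly3 set)" if big: "m \<in> big_xyz (4 * Q)" for m c
  proof -
    obtain i j k where m: "m = (i, j, k)" by (cases m)
    consider "4 * Q \<le> i" | "4 * Q \<le> j" | "4 * Q \<le> k" using big m by auto
    thus ?thesis
    proof cases
      case 1
      from mult[OF gen(1), of "Poly_Mapping.single (i - 4 * Q, j, k) c"] 1 show ?thesis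
        by (simp add: var_defs monomial_power mult_single m)
    next
      case 2
      from mult[OF gen(2), of "Poly_Mapping.single (i, j - 4 * Q, k) c"] 2 show ?thesis
        by (simp add: var_defs monomial_power mult_single m)
    next
      case 3
      from mult[OF gen(3), of "Poly_Mapping.single (i, j, k - 4 * Q) c"] 3 show ?thesis
        by (simp add: var_defs monomial_power mult_single m)
    qed
  qed
  show "supported (big_xyz (4 * Q)) \<subseteq> (O_ideal Q :: 'a poly3 set)"
  proof
    fix f :: "'a poly3" assume f: "f \<in> supported (big_xyz (4 * Q))"
    have "(\<Sum>m\<in>K. Poly_Mapping.single m (coeff3 f m)) \<in> O_ideal Q" 
      if "finite K" "K \<subseteq> Poly_Mapping.keys f" for K
      using that
    proof (induction K rule: finite_induct)
      case empty
      show ?case using I.zero_closed by simp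
    next
      case (insert m K)
      have "m \<in> big_xyz (4 * Q)" using insert.prems f by (auto simp: supported_def)
      from I.a_closed[OF mono[OF this, of "coeff3 f m"] insert.IH] insert show ?case by simp
    qed
    from this[of "Poly_Mapping.keys f"] show "f \<in> O_ideal Q"
      using sum_of_monomials[of f] by simp
  qed
qed

section \<open>Polynomials of small degree in the parameter\<close>

text \<open>
  In characteristic 2 these are the values at \<open>\<alpha>\<close> of the polynomials over \<open>\<int>/2\<close> of degree less
  than \<open>n\<close>, generated additively by powers of \<open>\<alpha>\<close>. Closure under sums and products then follows by rule induction without
  choosing representing polynomials.
\<close>

inductive_set F2_below :: "'a::comm_ring_1 \<Rightarrow> nat \<Rightarrow> 'a set" for \<alpha> :: 'a and n :: nat where
  zero: "0 \<in> F2_below \<alpha> n"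
| step: "x \<in> F2_below \<alpha> n \<Longrightarrow> i < n \<Longrightarrow> x + \<alpha> ^ i \<in> F2_below \<alpha> n"

lemma F2_below_add:
  assumes "x \<in> F2_below \<alpha> n" "y \<in> F2_below \<alpha> n"
  shows "x + y \<in> F2_below \<alpha> n"
  using assms(2)
proof (induction rule: F2_below.induct)
  case (step y i)
  from F2_below.step[OF step.IH step.hyps(2)] show ?case by (simp add: add.assoc)
qed (use assms(1) in simp)

lemma F2_below_power: "i < n \<Longrightarrow> \<alpha> ^ i \<in> F2_below \<alpha> n"
  using F2_below.step[OF F2_below.zero] by force

lemma F2_below_mono: "x \<in> F2_below \<alpha> m \<Longrightarrow> m \<le> n \<Longrightarrow> x \<in> F2_below \<alpha> n"
  by (induction rule: F2_below.induct) (auto intro: F2_below.intros)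

lemma F2_below_power_mult:
  "x \<in> F2_below \<alpha> m \<Longrightarrow> i + m \<le> n \<Longrightarrow> \<alpha> ^ i * x \<in> F2_below \<alpha> n"
proof (induction rule: F2_below.induct)
  case (step x j)
  hence "\<alpha> ^ i * x + \<alpha> ^ (i + j) \<in> F2_below \<alpha> n" by (intro F2_below.step) auto
  thus ?case by (simp add: distrib_left power_add)
qed (simp add: F2_below.zero)

lemma F2_below_mult:
  assumes "x \<in> F2_below \<alpha> m" "y \<in> F2_below \<alpha> n"
  shows "x * y \<in> F2_below \<alpha> (m + n - 1)"
  using assms(1)
proof (induction rule: F2_below.induct)
  case (step x i)
  hence "x * y + \<alpha> ^ i * y \<in> F2_below \<alpha> (m + n - 1)"
    by (intro F2_below_add F2_below_power_mult[OF assms(2)]) auto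
  thus ?case by (simp add: distrib_right)
qed (simp add: F2_below.zero)

lemma F2_below_sum:
  "(\<And>i. i \<in> I \<Longrightarrow> f i \<in> F2_below \<alpha> n) \<Longrightarrow> sum f I \<in> F2_below \<alpha> n"
  by (induction I rule: infinite_finite_induct) (auto intro: F2_below.zero F2_below_add)

lemma char_2_two_eq_0: "CHAR('a::comm_ring_1) = 2 \<Longrightarrow> (2::'a) = 0"
  by (metis of_nat_CHAR of_nat_numeral)

lemma char_2_uminus:
  assumes "(2::'a::comm_ring_1) = 0" shows "- x = (x::'a)"
proof -
  have "x + x = 2 * x" by simp
  hence "x + x = 0" using assms by simp
  thus ?thesis by (rule minus_unique)
qed

text \<open>
  In the generation of \<open>F2_below\<close> a power of \<open>\<alpha>\<close> may occur repeatedly; in characteristic 2 the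
  multiplicities collapse to 0 or 1.
\<close>

lemma F2_below_coefficients:
  fixes \<alpha> :: "'a::comm_ring_1"
  assumes "(2::'a) = 0" "x \<in> F2_below \<alpha> n"
  shows "\<exists>c. range c \<subseteq> {0, 1} \<and> x = (\<Sum>i<n. c i * \<alpha> ^ i)"
  using assms(2)
proof (induction rule: F2_below.induct)
  case zero
  show ?case by (rule exI[of _ "\<lambda>_. 0"]) auto
next
  case (step x i)
  then obtain c where c: "range c \<subseteq> {0, 1}" "x = (\<Sum>i<n. c i * \<alpha> ^ i)" by blast
  have two: "1 + 1 = (0::'a)" using assms(1) by simp
  define c' where "c' = c(i := c i + 1)"
  have "c i \<in> {0, 1}" using c(1) by auto
  hence "range c' \<subseteq> {0, 1}"
    using c(1) two by (auto simp: c'_def image_subset_iff)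
  moreover have "x + \<alpha> ^ i = (\<Sum>i<n. c' i * \<alpha> ^ i)"
  proof -
    have "(\<Sum>j<n. c' j * \<alpha> ^ j) = (\<Sum>j<n. c j * \<alpha> ^ j + (if j = i then \<alpha> ^ i else 0))"
      by (rule sum.cong) (auto simp: c'_def algebra_simps)
    also have "\<dots> = x + \<alpha> ^ i" using step.hyps by (simp add: sum.distrib c(2))
    finally show ?thesis ..
  qed
  ultimately show ?case by blast
qed

lemma eval_type_algebra:
  fixes x :: "'a::field"
  shows "ring.eval (ring_of_type_algebra :: 'a ring) p x = (\<Sum>i<length p. p ! (length p - 1 - i) * x ^ i)"
proof -
  interpret R: field "ring_of_type_algebra :: 'a ring" by (rule field_from_type_algebra)
  have pow: "x [^]\<^bsub>(ring_of_type_algebra :: 'a ring)\<^esub> (n::nat) = x ^ n" for n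
    by (induction n) (simp_all add: ring_of_type_algebra_def R.nat_pow_Suc2 nat_pow_def mult.commute)
  show ?thesis
  proof (induction p)
    case Nil
    show ?case
      using fun_cong[OF R.eval.simps(1)] by (simp add: ring_of_type_algebra_def)
  next
    case (Cons a p)
    have "(\<Sum>i<length p. (a # p) ! (length p - i) * x ^ i) =
        (\<Sum>i<length p. p ! (length p - 1 - i) * x ^ i)"
      by (rule sum.cong) (auto simp: nth_Cons split: nat.splits intro: arg_cong)
    thus ?case
      using Cons by (simp add: pow) (simp add: ring_of_type_algebra_def)
  qed
qed

text \<open>
  The only place where transcendence enters: a monic polynomial over \<open>\<int>/2\<close> does not vanish at \<open>\<alpha>\<close>.
\<close>

lemma transcendental_monic_neq_0:
  fixes \<alpha> :: "'a::field"
  assumes char: "CHAR('a) = 2" and tr: "transcendental_over_F2 \<alpha>" and d: "d \<in> F2_below \<alpha> n"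
  shows "\<alpha> ^ n + d \<noteq> 0"
proof
  assume eq: "\<alpha> ^ n + d = 0"
  interpret R: field "ring_of_type_algebra :: 'a ring" by (rule field_from_type_algebra)
  obtain c where c: "range c \<subseteq> {0, 1}" "d = (\<Sum>i<n. c i * \<alpha> ^ i)"
    using F2_below_coefficients[OF char_2_two_eq_0[OF char] d] by blast
  define p where "p = 1 # rev (map c [0..<n])"
  have p: "p \<in> carrier (univ_poly (ring_of_type_algebra :: 'a ring) {0, 1})"
    using c(1) by (auto simp: p_def univ_poly_def polynomial_def ring_of_type_algebra_def)
  have "(\<Sum>i<n. p ! (n - i) * \<alpha> ^ i) = (\<Sum>i<n. c i * \<alpha> ^ i)"
    by (rule sum.cong) (auto simp: p_def rev_nth nth_Cons split: nat.splits intro!: arg_cong[of _ _ c])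
  hence "R.eval p \<alpha> = \<alpha> ^ n + d"
    unfolding eval_type_algebra by (simp add: p_def c(2))
  hence "R.eval p \<alpha> = \<zero>\<^bsub>(ring_of_type_algebra :: 'a ring)\<^esub>"
    using eq by (simp add: ring_of_type_algebra_def)
  from R.eval_transcendental[OF _ p this] tr show False
    by (simp add: transcendental_over_F2_def p_def)
qed

text \<open>
  The matrix is \<open>\<alpha>\<^bsup>n\<^esup>\<close> times the identity plus entries of smaller degree in \<open>\<alpha>\<close>. Gaussian elimination
  without division preserves this form: multiplying the other equations by the pivot, which is
  monic of degree \<open>n\<close>, and eliminating one unknown gives a system of the same form with \<open>2n\<close> in place
  of \<open>n\<close>. Pivots are nonzero because \<open>\<alpha>\<close> is transcendental.
\<close>

lemma dominant_diagonal_system_trivial: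
  fixes \<alpha> :: "'a::field"
  assumes char: "CHAR('a) = 2" and tr: "transcendental_over_F2 \<alpha>" and fin: "finite I"
    and "\<And>k. k \<in> I \<Longrightarrow> (\<alpha> ^ n + r k) * v k = (\<Sum>j\<in>I. e k j * v j)"
    and "\<And>k. k \<in> I \<Longrightarrow> r k \<in> F2_below \<alpha> n"
    and "\<And>k j. k \<in> I \<Longrightarrow> j \<in> I \<Longrightarrow> e k j \<in> F2_below \<alpha> n"
    and "k \<in> I"
  shows "v k = 0"
  using fin assms(4-)
proof (induction I arbitrary: n r e k rule: finite_induct)
  case (insert x F)
  have neg: "- y = y" for y :: 'a
    by (rule char_2_uminus[OF char_2_two_eq_0[OF char]])
  \<comment> \<open>The pivot is \<open>\<alpha> ^ n + s\<close>; \<open>r'\<close> and \<open>e'\<close> describe the system after elimination of \<open>v x\<close>.\<close>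
  define s where "s = r x - e x x"
  define r' where "r' k = \<alpha> ^ n * r k + \<alpha> ^ n * s + s * r k" for k
  define e' where "e' k j = \<alpha> ^ n * e k j + s * e k j + e k x * e x j" for k j
  have s: "s \<in> F2_below \<alpha> n"
    unfolding s_def diff_conv_add_uminus neg by (intro F2_below_add insert.prems) auto
  have mult: "y * z \<in> F2_below \<alpha> (n + n)" if "y \<in> F2_below \<alpha> n" "z \<in> F2_below \<alpha> n" for y z
    using F2_below_mono[OF F2_below_mult[OF that]] by simp
  have pow_mult: "\<alpha> ^ n * y \<in> F2_below \<alpha> (n + n)" if "y \<in> F2_below \<alpha> n" for y
    using F2_below_power_mult[OF that] by simp
  have x_eq: "(\<alpha> ^ n + s) * v x = (\<Sum>j\<in>F. e x j * v j)"
    using insert.prems(1)[of x] insert.hyps by (simp add: s_def algebra_simps)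
  have "v k = 0" if "k \<in> F" for k
  proof (rule insert.IH[of "n + n" r' e'])
    fix k assume k: "k \<in> F"
    have "(\<alpha> ^ (n + n) + r' k) * v k = (\<alpha> ^ n + s) * ((\<alpha> ^ n + r k) * v k)"
      by (simp add: r'_def power_add algebra_simps)
    also have "\<dots> = e k x * ((\<alpha> ^ n + s) * v x) + (\<alpha> ^ n + s) * (\<Sum>j\<in>F. e k j * v j)"
      using insert.prems(1)[of k] insert.hyps k by (simp add: algebra_simps)
    also have "\<dots> = (\<Sum>j\<in>F. e' k j * v j)"
      unfolding x_eq by (simp add: e'_def sum_distrib_left sum.distrib algebra_simps)
    finally show "(\<alpha> ^ (n + n) + r' k) * v k = (\<Sum>j\<in>F. e' k j * v j)" .
    show "r' k \<in> F2_below \<alpha> (n + n)"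
      unfolding r'_def by (intro F2_below_add mult pow_mult insert.prems s) (use k in auto)
  next
    fix k j assume "k \<in> F" "j \<in> F"
    thus "e' k j \<in> F2_below \<alpha> (n + n)"
      unfolding e'_def by (intro F2_below_add mult pow_mult insert.prems s) auto
  qed (use that in auto)
  moreover from this have "(\<alpha> ^ n + s) * v x = 0" using x_eq by simp
  with transcendental_monic_neq_0[OF char tr s] have "v x = 0" by simp
  ultimately show ?case using insert.prems by blast
qed simp

definition coeffs_below :: "'a::comm_ring_1 \<Rightarrow> nat \<Rightarrow> 'a poly3 set" where
  "coeffs_below \<alpha> n = {f. \<forall>m. coeff3 f m \<in> F2_below \<alpha> n}"

lemma coeffs_below_add:
  "f \<in> coeffs_below \<alpha> n \<Longrightarrow> g \<in> coeffs_below \<alpha> n \<Longrightarrow> f + g \<in> coeffs_below \<alpha> n"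
  by (simp add: coeffs_below_def lookup_add F2_below_add)

lemma coeffs_below_mono: "f \<in> coeffs_below \<alpha> m \<Longrightarrow> m \<le> n \<Longrightarrow> f \<in> coeffs_below \<alpha> n"
  by (auto simp: coeffs_below_def intro: F2_below_mono)

lemma coeffs_below_single:
  "c \<in> F2_below \<alpha> n \<Longrightarrow> Poly_Mapping.single m c \<in> coeffs_below \<alpha> n"
  by (simp add: coeffs_below_def lookup_single when_def F2_below.zero)

lemma coeffs_below_sum:
  "(\<And>i. i \<in> I \<Longrightarrow> f i \<in> coeffs_below \<alpha> n) \<Longrightarrow> sum f I \<in> coeffs_below \<alpha> n"
  by (simp add: coeffs_below_def lookup_sum F2_below_sum)

lemma coeffs_below_mult:
  fixes f g :: "'a::comm_ring_1 poly3"
  assumes "f \<in> coeffs_below \<alpha> m" "g \<in> coeffs_below \<alpha> n" "m + n - 1 \<le> l"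
  shows "f * g \<in> coeffs_below \<alpha> l"
proof -
  have "f * g = (\<Sum>a\<in>Poly_Mapping.keys f. Poly_Mapping.single a (coeff3 f a)) *
      (\<Sum>b\<in>Poly_Mapping.keys g. Poly_Mapping.single b (coeff3 g b))"
    by (rule arg_cong2[OF sum_of_monomials sum_of_monomials])
  also have "\<dots> = (\<Sum>a\<in>Poly_Mapping.keys f. \<Sum>b\<in>Poly_Mapping.keys g.
      Poly_Mapping.single (a + b) (coeff3 f a * coeff3 g b))"
    by (simp only: sum_product mult_single)
  finally have eq: "f * g = (\<Sum>a\<in>Poly_Mapping.keys f. \<Sum>b\<in>Poly_Mapping.keys g.
      Poly_Mapping.single (a + b) (coeff3 f a * coeff3 g b))" .
  have "coeff3 f a * coeff3 g b \<in> F2_below \<alpha> l" for a b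
    using assms(1,2) by (intro F2_below_mono[OF F2_below_mult assms(3)])
      (auto simp: coeffs_below_def simp del: split_paired_All)
  thus ?thesis
    unfolding eq by (intro coeffs_below_sum coeffs_below_single)
qed


section \<open>Division by the quartic\<close>

abbreviation z_upto :: "nat \<Rightarrow> (nat \<times> nat \<times> nat) set" where
  "z_upto d \<equiv> {(i, j, k). k \<le> d}"

lemma z_upto_mult:
  assumes "f \<in> supported (z_upto d)" "g \<in> supported (z_upto e)" "d + e \<le> l"
  shows "f * g \<in> supported (z_upto l)"
  by (rule supported_mult[OF assms(1,2)]) (use assms(3) in auto)

lemma g_poly_monomials:
  "g_poly (\<alpha>::'a::comm_ring_1) = Poly_Mapping.single (0, 0, 4) 1 + Poly_Mapping.single (1, 1, 2) 1
    + Poly_Mapping.single (3, 0, 1) 1 + Poly_Mapping.single (0, 3, 1) 1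
    + Poly_Mapping.single (2, 2, 0) \<alpha>"
  by (simp add: g_poly_def P_poly_def var_defs monomial_power mult_single algebra_simps
      del: One_nat_def flip: numeral_2_eq_2)

lemma g_poly_homogeneous: "g_poly \<alpha> \<in> homogeneous3 4"
  unfolding g_poly_monomials homogeneous3_supported by (intro supported_add) auto

lemma g_poly_z_upto: "g_poly \<alpha> \<in> supported (z_upto 4)"
  unfolding g_poly_monomials by (intro supported_add) auto

text \<open>
  Since \<open>g\<close> is monic in \<open>z\<close>, division by \<open>g\<close> makes sense modulo \<open>(x\<^bsup>N\<^esup>, y\<^bsup>N\<^esup>)\<close>: among the monomials
  of \<open>u\<close> outside this ideal take one with the largest \<open>z\<close>-exponent \<open>k\<close>. The other terms of \<open>g\<close> have
  lower \<open>z\<close>-degree, so in \<open>g u\<close> its coefficient reappears unchanged with \<open>z\<close>-exponent \<open>k + 4\<close>,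
  which exceeds the \<open>z\<close>-degree of \<open>r\<close>.
\<close>

lemma g_poly_remainder:
  assumes eq: "g_poly \<alpha> * u - r \<in> supported (big_xy N)" and r: "r \<in> supported (z_upto 3)"
  shows "u \<in> supported (big_xy N)"
proof (rule ccontr)
  assume "u \<notin> supported (big_xy N)"
  define B where "B = {m \<in> Poly_Mapping.keys u. m \<notin> big_xy N}"
  have B: "finite B" "B \<noteq> {}"
    using \<open>u \<notin> _\<close> by (auto simp: B_def supported_def)
  define k where "k = Max ((snd \<circ> snd) ` B)"
  have "k \<in> (snd \<circ> snd) ` B" unfolding k_def using B by (intro Max_in) auto
  then obtain i j where ij: "(i, j, k) \<in> B" by auto
  have max: "c \<le> k" if "(a, b, c) \<in> B" for a b c
    unfolding k_def using B that by (intro Max_ge) (auto simp: image_iff intro!: bexI[of _ "(a, b, c)"])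
  have vanish: "coeff3 u (a, b, c) = 0" if "a \<le> i" "b \<le> j" "k < c" for a b c
    using max[of a b c] ij that by (auto simp: B_def in_keys_iff)
  have "coeff3 (g_poly \<alpha> * u) (i, j, k + 4) = coeff3 u (i, j, k)"
    by (simp add: g_poly_monomials distrib_right lookup_add lookup_single_times vanish)
  moreover have "coeff3 r (i, j, k + 4) = 0"
    using r by (simp add: supported_iff)
  moreover have "coeff3 (g_poly \<alpha> * u - r) (i, j, k + 4) = 0"
    using eq ij by (simp add: supported_iff B_def)
  ultimately show False
    using ij by (simp add: lookup_minus B_def in_keys_iff)
qed

lemma poly3_two_eq_0:
  assumes "(2::'a::comm_ring_1) = 0"
  shows "(2::'a poly3) = 0"
  using single_numeral[of "num.Bit0 num.One", where ?'a = "nat \<times> nat \<times> nat" and ?'b = 'a] assms by simp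

lemma z_power_4:
  assumes "(2::'a::comm_ring_1) = 0"
  shows "var_z ^ 4 = Poly_Mapping.single (1, 1, 0) 1 * var_z ^ 2
    + (Poly_Mapping.single (3, 0, 0) 1 + Poly_Mapping.single (0, 3, 0) 1) * var_z
    + Poly_Mapping.single (2, 2, 0) \<alpha> + g_poly (\<alpha>::'a)"
proof -
  define s where "s = Poly_Mapping.single (1, 1, 0) 1 * var_z ^ 2
    + (Poly_Mapping.single (3, 0, 0) 1 + Poly_Mapping.single (0, 3, 0) 1) * var_z
    + Poly_Mapping.single (2, 2, 0) \<alpha>"
  have "g_poly \<alpha> = var_z ^ 4 + s"
    by (simp add: g_poly_monomials s_def var_defs monomial_power mult_single distrib_right
        del: One_nat_def flip: numeral_2_eq_2)
  hence "s + g_poly \<alpha> = var_z ^ 4 + 2 * s" by (simp add: algebra_simps)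
  thus ?thesis by (simp add: s_def poly3_two_eq_0[OF assms])
qed

text \<open>
  The induction step squares the identity. In characteristic 2 squaring is additive, so the only
  new reduction is that of \<open>a\<^sup>2 z\<^sup>4\<close>, and \<open>(a, b, c)\<close> becomes
  \<open>(a\<^sup>2 A + b\<^sup>2, a\<^sup>2 B, c\<^sup>2 + a\<^sup>2 C)\<close>. Since \<open>A\<close> and \<open>B\<close> are free of \<open>\<alpha>\<close>, so are \<open>a\<close> and \<open>b\<close>.
\<close>

lemma z_power_reduction:
  fixes \<alpha> :: "'a::comm_ring_1"
  assumes two: "(2::'a) = 0"
  shows "\<exists>a b c t. a \<in> coeffs_below \<alpha> 1 \<inter> supported (z_upto 0)
    \<and> b \<in> coeffs_below \<alpha> 1 \<inter> supported (z_upto 0)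
    \<and> c \<in> coeffs_below \<alpha> (2 ^ n) \<inter> supported (z_upto 0)
    \<and> var_z ^ (4 * 2 ^ n) = Poly_Mapping.single (2 * 2 ^ n, 2 * 2 ^ n, 0) (\<alpha> ^ 2 ^ n)
        + (a * var_z ^ 2 + b * var_z + c) + g_poly \<alpha> * t"
proof (induction n)
  case 0
  have one: "1 \<in> F2_below \<alpha> 1" using F2_below_power[of 0 1 \<alpha>] by simp
  show ?case
  proof (intro exI conjI)
    show "Poly_Mapping.single (1, 1, 0) 1 \<in> coeffs_below \<alpha> 1 \<inter> supported (z_upto 0)"
      using one by (simp add: coeffs_below_single)
    show "Poly_Mapping.single (3, 0, 0) 1 + Poly_Mapping.single (0, 3, 0) 1
        \<in> coeffs_below \<alpha> 1 \<inter> supported (z_upto 0)"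
      using one by (intro IntI supported_add coeffs_below_add coeffs_below_single) auto
    show "0 \<in> coeffs_below \<alpha> (2 ^ 0) \<inter> supported (z_upto 0)"
      by (simp add: coeffs_below_def F2_below.zero)
    show "var_z ^ (4 * 2 ^ 0) = Poly_Mapping.single (2 * 2 ^ 0, 2 * 2 ^ 0, 0) (\<alpha> ^ 2 ^ 0)
        + (Poly_Mapping.single (1, 1, 0) 1 * var_z ^ 2
        + (Poly_Mapping.single (3, 0, 0) 1 + Poly_Mapping.single (0, 3, 0) 1) * var_z + 0)
        + g_poly \<alpha> * 1"
      using z_power_4[OF two, of \<alpha>] by (simp add: algebra_simps flip: numeral_2_eq_2)
  qed
next
  case (Suc n)
  define q :: nat where "q = 2 ^ n"
  define A :: "'a poly3" where "A = Poly_Mapping.single (1, 1, 0) 1"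
  define B :: "'a poly3" where "B = Poly_Mapping.single (3, 0, 0) 1 + Poly_Mapping.single (0, 3, 0) 1"
  define C :: "'a poly3" where "C = Poly_Mapping.single (2, 2, 0) \<alpha>"
  have q: "q \<ge> 1" by (simp add: q_def)
  from Suc obtain a b c t where
    a: "a \<in> coeffs_below \<alpha> 1" "a \<in> supported (z_upto 0)" and
    b: "b \<in> coeffs_below \<alpha> 1" "b \<in> supported (z_upto 0)" and
    c: "c \<in> coeffs_below \<alpha> q" "c \<in> supported (z_upto 0)" and
    eq: "var_z ^ (4 * q) = Poly_Mapping.single (2 * q, 2 * q, 0) (\<alpha> ^ q)
        + (a * var_z ^ 2 + b * var_z + c) + g_poly \<alpha> * t"
    unfolding q_def by blast
  have one: "1 \<in> F2_below \<alpha> 1" using F2_below_power[of 0 1 \<alpha>] by simp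
  have A: "A \<in> coeffs_below \<alpha> 1" "A \<in> supported (z_upto 0)"
    using one by (simp_all add: A_def coeffs_below_single)
  have B: "B \<in> coeffs_below \<alpha> 1" "B \<in> supported (z_upto 0)"
    unfolding B_def using one by (auto intro!: supported_add coeffs_below_add coeffs_below_single)
  have C: "C \<in> coeffs_below \<alpha> 2" "C \<in> supported (z_upto 0)"
    unfolding C_def using F2_below_power[of 1 2 \<alpha>] by (simp_all add: coeffs_below_single)
  have sq: "(x + y) ^ 2 = x ^ 2 + y ^ 2" for x y :: "'a poly3"
    by (simp add: power2_sum poly3_two_eq_0[OF two])
  have z4: "var_z ^ 4 = A * var_z ^ 2 + B * var_z + C + g_poly \<alpha>"
    unfolding A_def B_def C_def by (rule z_power_4[OF two])
  have "var_z ^ (4 * (2 * q)) = ((var_z ^ (4 * q)) ^ 2 :: 'a poly3)"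
    by (simp add: mult_ac flip: power_mult)
  also have "\<dots> = Poly_Mapping.single (2 * q, 2 * q, 0) (\<alpha> ^ q) ^ 2
      + (a ^ 2 * var_z ^ 4 + b ^ 2 * var_z ^ 2 + c ^ 2) + g_poly \<alpha> ^ 2 * t ^ 2"
    unfolding eq sq by (simp add: power_mult_distrib flip: power_mult)
  also have "Poly_Mapping.single (2 * q, 2 * q, 0) (\<alpha> ^ q) ^ 2 =
      Poly_Mapping.single (2 * (2 * q), 2 * (2 * q), 0) (\<alpha> ^ (2 * q))"
    by (simp add: power2_eq_square mult_single mult_2 flip: power_add)
  also have "Poly_Mapping.single (2 * (2 * q), 2 * (2 * q), 0) (\<alpha> ^ (2 * q))
      + (a ^ 2 * var_z ^ 4 + b ^ 2 * var_z ^ 2 + c ^ 2) + g_poly \<alpha> ^ 2 * t ^ 2 =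
      Poly_Mapping.single (2 * (2 * q), 2 * (2 * q), 0) (\<alpha> ^ (2 * q))
      + ((a * a * A + b * b) * var_z ^ 2 + a * a * B * var_z + (c * c + a * a * C))
      + g_poly \<alpha> * (a ^ 2 + g_poly \<alpha> * t ^ 2)"
    unfolding z4 by (simp add: algebra_simps power2_eq_square)
  finally have "var_z ^ (4 * 2 ^ Suc n) =
      Poly_Mapping.single (2 * 2 ^ Suc n, 2 * 2 ^ Suc n, 0) (\<alpha> ^ 2 ^ Suc n)
      + ((a * a * A + b * b) * var_z ^ 2 + a * a * B * var_z + (c * c + a * a * C))
      + g_poly \<alpha> * (a ^ 2 + g_poly \<alpha> * t ^ 2)"
    by (simp add: q_def)
  moreover have aa: "a * a \<in> coeffs_below \<alpha> 1" "a * a \<in> supported (z_upto 0)"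
    using coeffs_below_mult[OF a(1) a(1)] z_upto_mult[OF a(2) a(2), of 0] by simp_all
  have "a * a * A + b * b \<in> coeffs_below \<alpha> 1 \<inter> supported (z_upto 0)"
    by (intro IntI coeffs_below_add supported_add coeffs_below_mult[OF aa(1) A(1)]
        coeffs_below_mult[OF b(1) b(1)] z_upto_mult[OF aa(2) A(2)] z_upto_mult[OF b(2) b(2)]) auto
  moreover have "a * a * B \<in> coeffs_below \<alpha> 1 \<inter> supported (z_upto 0)"
    by (intro IntI coeffs_below_mult[OF aa(1) B(1)] z_upto_mult[OF aa(2) B(2)]) auto
  moreover have "c * c + a * a * C \<in> coeffs_below \<alpha> (2 * q) \<inter> supported (z_upto 0)"
    by (intro IntI coeffs_below_add supported_add coeffs_below_mult[OF aa(1) C(1)]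
        coeffs_below_mult[OF c(1) c(1)] z_upto_mult[OF aa(2) C(2)] z_upto_mult[OF c(2) c(2)])
      (use q in auto)
  hence "c * c + a * a * C \<in> coeffs_below \<alpha> (2 ^ Suc n) \<inter> supported (z_upto 0)"
    by (simp add: q_def)
  ultimately show ?case by blast
qed

text \<open>
  At most \<open>z\<^sup>5\<close> has to be reduced, and one substitution for \<open>z\<^sup>4\<close> in each term suffices. Only \<open>a\<close> and
  \<open>b\<close>, whose coefficients have \<open>\<alpha>\<close>-degree 0, are multiplied by \<open>A\<close>, \<open>B\<close>, \<open>C\<close>; the results have \<open>\<alpha>\<close>-degree
  at most 1, which is less than \<open>Q\<close>.
\<close>

lemma quadratic_times_z_power_reduction:
  fixes \<alpha> :: "'a::comm_ring_1"
  assumes two: "(2::'a) = 0" and Q: "Q \<ge> 2" and l: "l \<le> 3"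
    and a: "a \<in> coeffs_below \<alpha> 1" "a \<in> supported (z_upto 0)"
    and b: "b \<in> coeffs_below \<alpha> 1" "b \<in> supported (z_upto 0)"
    and c: "c \<in> coeffs_below \<alpha> Q" "c \<in> supported (z_upto 0)"
  shows "\<exists>\<rho> t. \<rho> \<in> coeffs_below \<alpha> Q \<inter> supported (z_upto 3)
    \<and> (a * var_z ^ 2 + b * var_z + c) * var_z ^ l = \<rho> + g_poly \<alpha> * t"
proof -
  define A :: "'a poly3" where "A = Poly_Mapping.single (1, 1, 0) 1"
  define B :: "'a poly3" where "B = Poly_Mapping.single (3, 0, 0) 1 + Poly_Mapping.single (0, 3, 0) 1"
  define C :: "'a poly3" where "C = Poly_Mapping.single (2, 2, 0) \<alpha>"
  have z4: "var_z ^ 4 = A * var_z ^ 2 + B * var_z + C + g_poly \<alpha>"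
    unfolding A_def B_def C_def by (rule z_power_4[OF two])
  have one: "1 \<in> F2_below \<alpha> 1" using F2_below_power[of 0 1 \<alpha>] by simp
  define G where "G = coeffs_below \<alpha> Q \<inter> supported (z_upto 3)"
  have G_add: "f + g \<in> G" if "f \<in> G" "g \<in> G" for f g
    using that by (auto simp: G_def intro: coeffs_below_add supported_add)
  have z: "var_z ^ i \<in> coeffs_below \<alpha> 1" "var_z ^ i \<in> supported (z_upto i)" for i
    using one by (simp_all add: var_defs monomial_power coeffs_below_single)
  have G: "f * var_z ^ i \<in> G" if "f \<in> coeffs_below \<alpha> Q" "f \<in> supported (z_upto 0)" "i \<le> 3" for f i
    unfolding G_def using coeffs_below_mult[OF that(1) z(1)] z_upto_mult[OF that(2) z(2)] that(3) by simp
  have A: "A \<in> coeffs_below \<alpha> 2" "A \<in> supported (z_upto 0)"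
    using F2_below_mono[OF one, of 2] by (simp_all add: A_def coeffs_below_single)
  have B: "B \<in> coeffs_below \<alpha> 2" "B \<in> supported (z_upto 0)"
    unfolding B_def using F2_below_mono[OF one, of 2]
    by (auto intro!: supported_add coeffs_below_add coeffs_below_single)
  have C: "C \<in> coeffs_below \<alpha> 2" "C \<in> supported (z_upto 0)"
    unfolding C_def using F2_below_power[of 1 2 \<alpha>] by (simp_all add: coeffs_below_single)
  have one_mult: "f * h * var_z ^ i \<in> G"
    if "f \<in> coeffs_below \<alpha> 1" "f \<in> supported (z_upto 0)"
      "h \<in> coeffs_below \<alpha> 2" "h \<in> supported (z_upto 0)" "i \<le> 3" for f h i
    using coeffs_below_mult[OF that(1,3), of Q] z_upto_mult[OF that(2,4), of 0] Q that(5)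
    by (intro G) auto
  have aQ: "a \<in> coeffs_below \<alpha> Q" and bQ: "b \<in> coeffs_below \<alpha> Q"
    using coeffs_below_mono[OF a(1)] coeffs_below_mono[OF b(1)] Q by auto
  note Gs = G[OF aQ a(2)] G[OF bQ b(2)] G[OF c] one_mult[OF a A] one_mult[OF a B] one_mult[OF a C]
    one_mult[OF b A] one_mult[OF b B] one_mult[OF b C]
  consider "l = 0" | "l = 1" | "l = 2" | "l = 3" using l by linarith
  hence "\<exists>\<rho> t. \<rho> \<in> G \<and> (a * var_z ^ 2 + b * var_z + c) * var_z ^ l = \<rho> + g_poly \<alpha> * t"
  proof cases
    case 1
    have "(a * var_z ^ 2 + b * var_z + c) * var_z ^ l =
        (a * var_z ^ 2 + b * var_z ^ 1 + c * var_z ^ 0) + g_poly \<alpha> * 0"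
      by (simp add: 1)
    moreover have "a * var_z ^ 2 + b * var_z ^ 1 + c * var_z ^ 0 \<in> G"
      by (intro G_add Gs) auto
    ultimately show ?thesis by blast
  next
    case 2
    have "(a * var_z ^ 2 + b * var_z + c) * var_z ^ l =
        (a * var_z ^ 3 + b * var_z ^ 2 + c * var_z ^ 1) + g_poly \<alpha> * 0"
      by (simp add: 2 algebra_simps power2_eq_square power3_eq_cube)
    moreover have "a * var_z ^ 3 + b * var_z ^ 2 + c * var_z ^ 1 \<in> G"
      by (intro G_add Gs) auto
    ultimately show ?thesis by blast
  next
    case 3
    have "(a * var_z ^ 2 + b * var_z + c) * var_z ^ l = a * var_z ^ 4 + b * var_z ^ 3 + c * var_z ^ 2"
      by (simp add: 3 algebra_simps power2_eq_square power3_eq_cube power4_eq_xxxx)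
    also have "\<dots> = (a * A * var_z ^ 2 + a * B * var_z ^ 1 + a * C * var_z ^ 0
        + b * var_z ^ 3 + c * var_z ^ 2) + g_poly \<alpha> * a"
      unfolding z4 by (simp add: algebra_simps)
    finally have "(a * var_z ^ 2 + b * var_z + c) * var_z ^ l = \<dots>" .
    moreover have "a * A * var_z ^ 2 + a * B * var_z ^ 1 + a * C * var_z ^ 0
        + b * var_z ^ 3 + c * var_z ^ 2 \<in> G"
      by (intro G_add Gs) auto
    ultimately show ?thesis by blast
  next
    case 4
    have "(a * var_z ^ 2 + b * var_z + c) * var_z ^ l =
        a * var_z * var_z ^ 4 + b * var_z ^ 4 + c * var_z ^ 3"
      by (simp add: 4 algebra_simps power2_eq_square power3_eq_cube power4_eq_xxxx)
    also have "\<dots> = (a * A * var_z ^ 3 + a * B * var_z ^ 2 + a * C * var_z ^ 1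
        + b * A * var_z ^ 2 + b * B * var_z ^ 1 + b * C * var_z ^ 0
        + c * var_z ^ 3) + g_poly \<alpha> * (a * var_z + b)"
      unfolding z4 by (simp add: algebra_simps power2_eq_square power3_eq_cube)
    finally have "(a * var_z ^ 2 + b * var_z + c) * var_z ^ l = \<dots>" .
    moreover have "a * A * var_z ^ 3 + a * B * var_z ^ 2 + a * C * var_z ^ 1
        + b * A * var_z ^ 2 + b * B * var_z ^ 1 + b * C * var_z ^ 0 + c * var_z ^ 3 \<in> G"
      by (intro G_add Gs) auto
    ultimately show ?thesis by blast
  qed
  thus ?thesis by (simp add: G_def)
qed


section \<open>Injectivity of multiplication by the quartic\<close>

definition shift_z :: "nat \<Rightarrow> 'a::comm_ring_1 poly3 \<Rightarrow> 'a poly3" where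
  "shift_z N f = Poly_Mapping.map_key (\<lambda>(i, j, k). (i, j, k + N)) f"

lemma coeff3_shift_z: "coeff3 (shift_z N f) (i, j, k) = coeff3 f (i, j, k + N)"
  by (simp add: shift_z_def map_key.rep_eq inj_on_def)

text \<open>
  The heart of the argument: \<open>z\<^bsup>4Q\<^esup> h\<close> lies in the ideal \<open>(g, x\<^bsup>4Q\<^esup>, y\<^bsup>4Q\<^esup>)\<close> only for \<open>h = 0\<close>, by comparing
  degrees in \<open>\<alpha>\<close> in the remainder of \<open>z\<^bsup>4Q\<^esup> h\<close> on division by \<open>g\<close>.
\<close>

lemma z_power_multiple_trivial:
  fixes \<alpha> :: "'a::field"
  assumes char: "CHAR('a) = 2" and tr: "transcendental_over_F2 \<alpha>" and Q: "Q = 2 ^ n" "Q \<ge> 2"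
    and h: "h \<in> homogeneous3 (2 * Q - 1)" "h \<in> supported (z_upto 3)"
    and eq: "g_poly \<alpha> * f - var_z ^ (4 * Q) * h \<in> supported (big_xy (4 * Q))"
  shows "h = 0"
proof -
  let ?K = "Poly_Mapping.keys h"
  define M :: "'a poly3" where "M = Poly_Mapping.single (2 * Q, 2 * Q, 0) (\<alpha> ^ Q)"
  have two: "(2::'a) = 0" by (rule char_2_two_eq_0[OF char])
  obtain a b c t where
    a: "a \<in> coeffs_below \<alpha> 1" "a \<in> supported (z_upto 0)" and
    b: "b \<in> coeffs_below \<alpha> 1" "b \<in> supported (z_upto 0)" and
    c: "c \<in> coeffs_below \<alpha> Q" "c \<in> supported (z_upto 0)" and
    z: "var_z ^ (4 * Q) = M + (a * var_z ^ 2 + b * var_z + c) + g_poly \<alpha> * t"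
    using z_power_reduction[OF two, of \<alpha> n] unfolding M_def Q(1) by blast
  have "\<exists>\<phi> s. \<phi> \<in> coeffs_below \<alpha> Q \<inter> supported (z_upto 3) \<and>
      (a * var_z ^ 2 + b * var_z + c) * Poly_Mapping.single m 1 = \<phi> + g_poly \<alpha> * s" if "m \<in> ?K" for m
  proof -
    obtain i j l where m: "m = (i, j, l)" by (cases m)
    have l: "l \<le> 3" using h(2) that by (auto simp: m supported_def)
    define u :: "'a poly3" where "u = Poly_Mapping.single (i, j, 0) 1"
    from quadratic_times_z_power_reduction[OF two Q(2) l a b c] obtain \<rho> s where
      \<rho>: "\<rho> \<in> coeffs_below \<alpha> Q" "\<rho> \<in> supported (z_upto 3)"
      and eq: "(a * var_z ^ 2 + b * var_z + c) * var_z ^ l = \<rho> + g_poly \<alpha> * s"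
      by blast
    have u: "u \<in> coeffs_below \<alpha> 1" "u \<in> supported (z_upto 0)"
      using F2_below_power[of 0 1 \<alpha>] by (simp_all add: u_def coeffs_below_single)
    have "Poly_Mapping.single m 1 = var_z ^ l * u"
      by (simp add: m u_def var_defs monomial_power mult_single)
    hence "(a * var_z ^ 2 + b * var_z + c) * Poly_Mapping.single m 1 = \<rho> * u + g_poly \<alpha> * (s * u)"
      using arg_cong[OF eq, of "\<lambda>x. x * u"] by (simp add: distrib_right mult.assoc)
    moreover have "\<rho> * u \<in> coeffs_below \<alpha> Q \<inter> supported (z_upto 3)"
      using coeffs_below_mult[OF \<rho>(1) u(1)] z_upto_mult[OF \<rho>(2) u(2)] by simp
    ultimately show ?thesis by blast
  qed
  then obtain \<phi> s where \<phi>: "\<And>m. m \<in> ?K \<Longrightarrow> \<phi> m \<in> coeffs_below \<alpha> Q"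
    "\<And>m. m \<in> ?K \<Longrightarrow> \<phi> m \<in> supported (z_upto 3)"
    and \<phi>_eq: "\<And>m. m \<in> ?K \<Longrightarrow>
      (a * var_z ^ 2 + b * var_z + c) * Poly_Mapping.single m 1 = \<phi> m + g_poly \<alpha> * s m"
    by (metis IntE)
  \<comment> \<open>\<open>r\<close> is the remainder and \<open>T\<close> the quotient of \<open>z\<^bsup>4Q\<^esup> h\<close> on division by \<open>g\<close>.\<close>
  define r where "r = M * h + (\<Sum>m\<in>?K. const3 (coeff3 h m) * \<phi> m)"
  define T where "T = t * h + (\<Sum>m\<in>?K. const3 (coeff3 h m) * s m)"
  have "(a * var_z ^ 2 + b * var_z + c) * h = (a * var_z ^ 2 + b * var_z + c) *
      (\<Sum>m\<in>?K. Poly_Mapping.single m (coeff3 h m))"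
    by (rule arg_cong[OF sum_of_monomials])
  also have "\<dots> = (\<Sum>m\<in>?K. const3 (coeff3 h m) *
      ((a * var_z ^ 2 + b * var_z + c) * Poly_Mapping.single m 1))"
    unfolding sum_distrib_left
  proof (rule sum.cong)
    fix m
    have "Poly_Mapping.single m (coeff3 h m) = const3 (coeff3 h m) * Poly_Mapping.single m 1"
      by (simp add: const3_def mult_single flip: zero_prod_def)
    thus "(a * var_z ^ 2 + b * var_z + c) * Poly_Mapping.single m (coeff3 h m) =
        const3 (coeff3 h m) * ((a * var_z ^ 2 + b * var_z + c) * Poly_Mapping.single m 1)"
      by (simp only: mult.left_commute)
  qed simp
  also have "\<dots> = (\<Sum>m\<in>?K. const3 (coeff3 h m) * \<phi> m)
      + g_poly \<alpha> * (\<Sum>m\<in>?K. const3 (coeff3 h m) * s m)"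
    unfolding sum_distrib_left sum.distrib[symmetric]
    by (rule sum.cong) (simp_all add: \<phi>_eq distrib_left mult.left_commute)
  finally have "var_z ^ (4 * Q) * h = r + g_poly \<alpha> * T"
    unfolding z r_def T_def by (simp add: algebra_simps)
  hence rem: "g_poly \<alpha> * (f - T) - r \<in> supported (big_xy (4 * Q))"
    using eq by (simp add: algebra_simps)
  have "r \<in> supported (z_upto 3)"
    unfolding r_def M_def
    by (intro supported_add supported_sum z_upto_mult[OF _ h(2), of _ 0]
        z_upto_mult[OF _ \<phi>(2), of _ 0]) (auto simp: const3_def)
  from g_poly_remainder[OF rem this] have "g_poly \<alpha> * (f - T) \<in> supported (big_xy (4 * Q))"
    by (rule big_xy_mult)
  from supported_diff[OF this rem] have r: "r \<in> supported (big_xy (4 * Q))" by simp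
  have "coeff3 h m = 0" if "m \<in> ?K" for m
  proof (rule dominant_diagonal_system_trivial[OF char tr, of ?K Q "\<lambda>_. 0" "coeff3 h"
        "\<lambda>m m'. coeff3 (\<phi> m') (m + (2 * Q, 2 * Q, 0))"])
    fix m assume m: "m \<in> ?K"
    obtain i j l where ijl: "m = (i, j, l)" by (cases m)
    \<comment> \<open>The degree of \<open>h\<close> keeps the shifted exponents \<open>i + 2Q\<close> and \<open>j + 2Q\<close> below \<open>4Q\<close>.\<close>
    have "i + j + l = 2 * Q - 1" using h(1) m ijl by (auto simp: homogeneous3_def)
    hence "m + (2 * Q, 2 * Q, 0) \<notin> big_xy (4 * Q)" using Q(2) by (auto simp: ijl)
    hence "coeff3 r (m + (2 * Q, 2 * Q, 0)) = 0" by (rule supported_coeff[OF r])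
    moreover have "coeff3 (M * h) (m + (2 * Q, 2 * Q, 0)) = \<alpha> ^ Q * coeff3 h m"
      by (simp add: ijl M_def lookup_single_times)
    moreover have "coeff3 (const3 x * p) m' = x * coeff3 p m'" for x :: 'a and p m'
      by (cases m') (simp add: const3_def lookup_single_times)
    ultimately have "\<alpha> ^ Q * coeff3 h m
        + (\<Sum>m'\<in>?K. coeff3 h m' * coeff3 (\<phi> m') (m + (2 * Q, 2 * Q, 0))) = 0"
      unfolding r_def lookup_add lookup_sum by simp
    from minus_unique[OF this] show "(\<alpha> ^ Q + 0) * coeff3 h m =
        (\<Sum>m'\<in>?K. coeff3 (\<phi> m') (m + (2 * Q, 2 * Q, 0)) * coeff3 h m')"
      unfolding char_2_uminus[OF two] by (simp add: mult.commute)
  next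
    fix m m' assume "m' \<in> ?K"
    from \<phi>(1)[OF this] show "coeff3 (\<phi> m') (m + (2 * Q, 2 * Q, 0)) \<in> F2_below \<alpha> Q"
      by (cases m) (simp add: coeffs_below_def)
  qed (use that in \<open>auto intro: F2_below.zero\<close>)
  hence "?K = {}" using in_keys_iff[of _ h] by blast
  thus "h = 0" by simp
qed

text \<open>
  After removal of the monomials of \<open>f\<close> that vanish in \<open>O\<close>, the part of \<open>g f\<close> outside
  \<open>(x\<^bsup>4Q\<^esup>, y\<^bsup>4Q\<^esup>)\<close> is divisible by \<open>z\<^bsup>4Q\<^esup>\<close> with a quotient \<open>h\<close> of degree
  \<open>(6Q - 5) + 4 - 4Q = 2Q - 1\<close>, and of \<open>z\<close>-degree at most \<open>(4Q - 1) + 4 - 4Q = 3\<close>.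
\<close>

lemma g_poly_mult_injective:
  fixes \<alpha> :: "'a::field"
  assumes char: "CHAR('a) = 2" and tr: "transcendental_over_F2 \<alpha>" and Q: "Q = 2 ^ n" "Q \<ge> 2"
    and f: "f \<in> homogeneous3 (6 * Q - 5)"
    and gf: "g_poly \<alpha> * f \<in> supported (big_xyz (4 * Q))"
  shows "f \<in> supported (big_xyz (4 * Q))"
proof -
  define f' where "f' = Poly_Mapping.mapp (\<lambda>m c. c when m \<notin> big_xyz (4 * Q)) f"
  have f'_coeff: "coeff3 f' m = (coeff3 f m when m \<notin> big_xyz (4 * Q))" for m
    by (auto simp: f'_def lookup_mapp when_def in_keys_iff)
  have diff: "f - f' \<in> supported (big_xyz (4 * Q))"
    unfolding supported_iff by (auto simp: lookup_minus f'_coeff)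
  have f'_hom: "f' \<in> homogeneous3 (6 * Q - 5)"
    using f unfolding homogeneous3_supported supported_iff by (auto simp: f'_coeff when_def)
  have f'_z: "f' \<in> supported (z_upto (4 * Q - 1))"
    unfolding supported_iff by (auto simp: f'_coeff when_def)
  define p where "p = g_poly \<alpha> * f'"
  have p_mem: "p \<in> supported (big_xyz (4 * Q))"
    using supported_diff[OF gf big_xyz_mult[OF diff, of "g_poly \<alpha>"]]
    by (simp add: p_def algebra_simps)
  have p_z: "p \<in> supported (z_upto (4 * Q + 3))"
    unfolding p_def by (rule z_upto_mult[OF g_poly_z_upto f'_z]) (use Q in auto)
  have p_hom: "p \<in> homogeneous3 (6 * Q - 1)"
    using g_poly_homogeneous[of \<alpha>] f'_hom unfolding p_def homogeneous3_supported
    by (rule supported_mult) (use Q in auto)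
  define h where "h = Poly_Mapping.mapp (\<lambda>m c. c when m \<notin> big_xy (4 * Q)) (shift_z (4 * Q) p)"
  have h_coeff: "coeff3 h (i, j, k) = (coeff3 p (i, j, k + 4 * Q) when (i, j, k) \<notin> big_xy (4 * Q))" for i j k
    by (auto simp: h_def lookup_mapp when_def in_keys_iff coeff3_shift_z)
  have "h \<in> homogeneous3 (2 * Q - 1)"
    using p_hom Q(2) unfolding homogeneous3_supported supported_iff by (auto simp: h_coeff when_def)
  moreover have "h \<in> supported (z_upto 3)"
    using p_z unfolding supported_iff by (auto simp: h_coeff when_def)
  moreover have "g_poly \<alpha> * f' - var_z ^ (4 * Q) * h \<in> supported (big_xy (4 * Q))"
    using p_mem unfolding supported_iff
    by (auto simp: p_def[symmetric] lookup_minus var_defs monomial_power lookup_single_times h_coeff)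
  ultimately have "h = 0"
    by (rule z_power_multiple_trivial[OF char tr Q])
  hence "g_poly \<alpha> * f' - 0 \<in> supported (big_xy (4 * Q))"
    using \<open>g_poly \<alpha> * f' - var_z ^ (4 * Q) * h \<in> _\<close> by simp
  from g_poly_remainder[OF this] have "f' \<in> supported (big_xy (4 * Q))" by simp
  hence "f' \<in> supported (big_xyz (4 * Q))" by (auto simp: supported_def)
  from supported_add[OF diff this] show ?thesis by simp
qed

section \<open>Passage to the quotient ring\<close>

lemma O_class_eq_iff: "O_class Q f = O_class Q g \<longleftrightarrow> f - g \<in> O_ideal Q"
proof -
  interpret cring "poly3_ring :: 'a poly3 ring" by (rule cring_poly3)
  have "ideal (O_ideal Q) (poly3_ring :: 'a poly3 ring)"
    unfolding O_ideal_eq by (rule ideal_supported_big_xyz)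
  from quotient_eq_iff_same_a_r_cos[OF this, of f g] show ?thesis
    by (simp add: O_class_def poly3_minus)
qed

lemma mult_g_class: "mult_g Q \<alpha> (O_class Q f) = O_class Q (g_poly \<alpha> * f)"
proof -
  interpret ideal "O_ideal Q" "poly3_ring :: 'a poly3 ring"
    unfolding O_ideal_eq by (rule ideal_supported_big_xyz)
  show ?thesis
    using rcoset_mult_add[of "g_poly \<alpha>" f] by (simp add: mult_g_def O_ring_def FactRing_def O_class_def)
qed

lemma O_ring_zero: "\<zero>\<^bsub>O_ring Q\<^esub> = O_class Q (0 :: 'a::comm_ring_1 poly3)"
proof -
  interpret cring "poly3_ring :: 'a poly3 ring" by (rule cring_poly3)
  have "ideal (O_ideal Q) (poly3_ring :: 'a poly3 ring)"
    unfolding O_ideal_eq by (rule ideal_supported_big_xyz)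
  from a_rcos_zero[OF this additive_subgroup.zero_closed[OF ideal.axioms(1)[OF this]]] show ?thesis
    by (simp add: O_ring_def FactRing_def O_class_def)
qed

theorem theorem3p13:
  fixes \<alpha> :: "'a::field" and Q :: nat
  assumes "CHAR('a) = 2"
    and "transcendental_over_F2 \<alpha>"
    and "Q \<ge> 2" and "\<exists>n. Q = 2 ^ n"
  shows "N_kernel Q \<alpha> (6 * Q - 5) = {\<zero>\<^bsub>O_ring Q\<^esub>}
    \<and> mult_g Q \<alpha> \<in> O_component Q (6 * Q - 5) \<rightarrow> O_component Q (6 * Q - 1)
    \<and> inj_on (mult_g Q \<alpha>) (O_component Q (6 * Q - 5))"
proof -
  obtain n where n: "Q = 2 ^ n" using assms(4) by blast
  have inj: "f \<in> O_ideal Q" if "f \<in> homogeneous3 (6 * Q - 5)" "g_poly \<alpha> * f \<in> O_ideal Q" for f :: "'a poly3"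
    using g_poly_mult_injective[OF assms(1,2) n assms(3)] that by (simp add: O_ideal_eq)
  have zero_hom: "(0 :: 'a poly3) \<in> homogeneous3 (6 * Q - 5)" by (simp add: homogeneous3_supported)
  have inj_on: "inj_on (mult_g Q \<alpha>) (O_component Q (6 * Q - 5))"
  proof (rule inj_onI)
    fix u v :: "'a poly3 set"
    assume "u \<in> O_component Q (6 * Q - 5)" "v \<in> O_component Q (6 * Q - 5)"
      and eq: "mult_g Q \<alpha> u = mult_g Q \<alpha> v"
    then obtain f f' where f: "f \<in> homogeneous3 (6 * Q - 5)" "u = O_class Q f"
      and f': "f' \<in> homogeneous3 (6 * Q - 5)" "v = O_class Q f'"
      by (auto simp: O_component_def)
    have "f - f' \<in> O_ideal Q"
    proof (rule inj)
      show "f - f' \<in> homogeneous3 (6 * Q - 5)"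
        using f f' unfolding homogeneous3_supported by (intro supported_diff)
      show "g_poly \<alpha> * (f - f') \<in> O_ideal Q"
        using eq by (simp add: f f' mult_g_class O_class_eq_iff algebra_simps)
    qed
    thus "u = v" by (simp add: f f' O_class_eq_iff)
  qed
  moreover have "N_kernel Q \<alpha> (6 * Q - 5) = {\<zero>\<^bsub>O_ring Q\<^esub>}"
  proof -
    have zero: "\<zero>\<^bsub>O_ring Q\<^esub> \<in> (O_component Q (6 * Q - 5) :: 'a poly3 set set)"
      unfolding O_ring_zero O_component_def using zero_hom by blast
    moreover have "mult_g Q \<alpha> \<zero>\<^bsub>O_ring Q\<^esub> = \<zero>\<^bsub>O_ring Q\<^esub>"
      by (simp add: O_ring_zero mult_g_class)
    ultimately have "u \<in> N_kernel Q \<alpha> (6 * Q - 5) \<longleftrightarrow> u = \<zero>\<^bsub>O_ring Q\<^esub>" for u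
      using inj_onD[OF inj_on, of u "\<zero>\<^bsub>O_ring Q\<^esub>"] unfolding N_kernel_def by auto
    thus ?thesis by blast
  qed
  moreover have "mult_g Q \<alpha> \<in> O_component Q (6 * Q - 5) \<rightarrow> O_component Q (6 * Q - 1)"
  proof
    fix u :: "'a poly3 set"
    assume "u \<in> O_component Q (6 * Q - 5)"
    then obtain f where f: "f \<in> homogeneous3 (6 * Q - 5)" "u = O_class Q f"
      by (auto simp: O_component_def)
    have "g_poly \<alpha> * f \<in> homogeneous3 (6 * Q - 1)"
      using g_poly_homogeneous[of \<alpha>] f(1) unfolding homogeneous3_supported
      by (rule supported_mult) (use assms(3) in auto)
    thus "mult_g Q \<alpha> u \<in> O_component Q (6 * Q - 1)"
      by (auto simp: f mult_g_class O_component_def)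
  qed
  ultimately show ?thesis by blast
qed

end
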